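(* Let $U=(U_y)_{y\in\mathbb{Z}}$ and $V=(V_x)_{x\in\mathbb{Z}}$ be families of random variables with values in $\{-1,1\}$, all independent, each equal to $+1$ or $-1$ with probability $1/2$. Define $Z=(Z_n)_{n\ge 0}=((X_n,Y_n))_{n\ge 0}$ in $\mathbb{Z}^2$ by $Z_0=(0,0)$ and $Z_{n+1}=Z_n+(U_{Y_n},V_{X_n})$ for all $n\ge 0$. Then, almost surely, $Z$ gets eventually stuck on one edge, i.e. it is eventually 2-periodic: there exists $N$ such that $Z_{n+2}=Z_n$ for all $n\ge N$.
   Context: $U_y$ is the orientation of the horizontal line at height $y$, and $V_x$ that of the vertical line at abscissa $x$. The walk $Z$ is a deterministic function of $(U,V)$. *)

theory Defs
  imports "HOL-Probability.Probability"
begin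

primrec walk :: "(int \<Rightarrow> int) \<Rightarrow> (int \<Rightarrow> int) \<Rightarrow> nat \<Rightarrow> int \<times> int" where
  "walk u v 0 = (0, 0)"
| "walk u v (Suc n) = walk u v n + (u (snd (walk u v n)), v (fst (walk u v n)))"

end

theory Submission imports Defs begin

text \<open>
  The proof has a deterministic half and a probabilistic half.

  A bounded orbit gets stuck for every choice of orientations
  (\<open>walk_eventually_two_periodic_if_bounded\<close>). It is eventually periodic, and as soon as the walk reverses
  its direction it oscillates on one edge. A cycle without reversal would be a simple closed curve, because diagonal edges
  between points with even coordinate sum do not cross; so its direction would rotate by exactly one full turn
  (\<open>turning_number_simple_closed\<close>). On the other hand the walk is a discrete Hamiltonian flow: the direction at \<open>(x, y)\<close> is
  \<open>(U y, V x)\<close>, and the rotation accumulated along the walk is a function of the position. Hence it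
  vanishes along a cycle, a contradiction.

  The orbit is almost surely bounded. By symmetry it suffices to bound the abscissa from above
  (\<open>AE_bounded_right\<close>). When the walk first reaches a column on the right, the orientation of this column is
  still independent of the past. If moreover the current row points back to the left, the walk gets stuck with conditional
  probability one half; as this can happen only once, such arrivals occur finitely often
  (\<open>AE_eventually_not_blocked\<close>). If nevertheless there are infinitely many new columns, then from some time on each step of the walk reaches
  a new column, so that its height performs a simple random walk among rows pointing to the right. This is
  impossible, because such a random walk does not stay between two rows pointing to the left.
\<close>

section \<open>The turning number of a simple closed lattice path\<close>

text \<open>The half-plane is half-open so that its vectors have an argument in $[0,\pi)$ without exception: seen from
  the lowest and, among those, leftmost of finitely many points, all the other points lie in it.\<close>

definition upper :: "int \<times> int \<Rightarrow> bool" where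
  "upper w \<longleftrightarrow> snd w > 0 \<or> (snd w = 0 \<and> fst w > 0)"

text \<open>The signed number of times that a diagonal unit step from \<open>w\<close> to \<open>w'\<close> crosses a ray from the origin, namely
  the positive horizontal axis pushed slightly downwards. A step that changes half-plane either crosses this
  ray or passes the origin on the other side; as its end points are distinct from the origin, the sign of
  the abscissa of its midpoint tells which. Summed along a closed path that avoids the origin, this is the winding number.\<close>

definition cut_crossing :: "int \<times> int \<Rightarrow> int \<times> int \<Rightarrow> int" where
  "cut_crossing w w' = (if fst w + fst w' > 0 then of_bool (upper w') - of_bool (upper w) else 0)"

definition diagonal :: "int \<times> int \<Rightarrow> bool" where
  "diagonal d \<longleftrightarrow> fst d \<in> {-1, 1} \<and> snd d \<in> {-1, 1}"

text \<open>The index of a diagonal direction in the counterclockwise order that starts with \<open>(1, 1)\<close>.\<close>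

definition quadrant :: "int \<times> int \<Rightarrow> int" where
  "quadrant d = (if snd d > 0 then (if fst d > 0 then 0 else 1) else (if fst d > 0 then 3 else 2))"

text \<open>The turn from direction \<open>a\<close> to direction \<open>b\<close>, decomposed into the two diagonal steps from \<open>a\<close> over
  \<open>a + b\<close> to \<open>b\<close>, which avoid the origin unless \<open>b = - a\<close>. Its sum over a closed path counts the full
  rotations of the direction.\<close>

definition turn_crossing :: "int \<times> int \<Rightarrow> int \<times> int \<Rightarrow> int" where
  "turn_crossing a b = cut_crossing a (a + b) + cut_crossing (a + b) b"

definition det2 :: "int \<times> int \<Rightarrow> int \<times> int \<Rightarrow> int" where
  "det2 a b = fst a * snd b - fst b * snd a"

lemma diagonal_cases:
  assumes "diagonal d"
  obtains "d = (1, 1)" | "d = (1, -1)" | "d = (-1, 1)" | "d = (-1, -1)"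
  using assms by (cases d) (auto simp: diagonal_def)

text \<open>A turn by a quarter has \<open>det2 a b = \<plusminus>2\<close> and changes the quadrant index by \<open>\<plusminus>1\<close> modulo \<open>4\<close>; the wrap-around
  of this index happens exactly at the ray. Along a closed path the quadrant indices cancel, and
  eight times the turning number is the sum of the determinants.\<close>

lemma turn_crossing_eq:
  assumes "diagonal a" "diagonal b" "a + b \<noteq> 0"
  shows "8 * turn_crossing a b = det2 a b + 2 * (quadrant a - quadrant b)"
  using assms(3)
  by (cases rule: diagonal_cases[OF assms(1)]; cases rule: diagonal_cases[OF assms(2)])
     (simp_all add: turn_crossing_def cut_crossing_def upper_def det2_def quadrant_def zero_prod_def)

text \<open>Homotopy invariance of the crossing number over one square: the four points bound a cell of the diagonal
  lattice (a segment or two when \<open>a = \<plusminus>b\<close>), which contains no further point with even coordinate sum. So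
  the origin is not enclosed and the two ways around the cell cross the ray equally often.\<close>

lemma cut_crossing_square:
  assumes "even (fst w + snd w)" "diagonal a" "diagonal b"
    and "w \<noteq> 0" "w + b \<noteq> 0" "w - a \<noteq> 0" "w + b - a \<noteq> 0"
  shows "cut_crossing w (w + b) + cut_crossing (w + b) (w + b - a) =
         cut_crossing w (w - a) + cut_crossing (w - a) (w + b - a)"
proof -
  obtain x y where w: "w = (x, y)" by (cases w)
  \<comment> \<open>Eliminating the parity condition leaves linear integer arithmetic.\<close>
  obtain k where "x + y = 2 * k" using assms(1) unfolding w dvd_def by auto
  then have x: "x = 2 * k - y" by simp
  show ?thesis
    using assms(4-7)
    by (cases rule: diagonal_cases[OF assms(2)]; cases rule: diagonal_cases[OF assms(3)];
      simp add: w x cut_crossing_def upper_def zero_prod_def of_bool_def del: One_nat_def; smt (verit))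
qed

lemma cut_crossing_upper: "upper w \<Longrightarrow> upper w' \<Longrightarrow> cut_crossing w w' = 0"
  by (simp add: cut_crossing_def)

lemma cut_crossing_lower: "\<not> upper w \<Longrightarrow> \<not> upper w' \<Longrightarrow> cut_crossing w w' = 0"
  by (simp add: cut_crossing_def)

text \<open>A discrete form of the proof of the Umlaufsatz by H. Hopf. The directions of the path are the secants
  \<open>secant i (Suc i)\<close>, so the rotation of the direction is the variation of the secant along the hypotenuse
  of the triangle of all pairs \<open>i < j\<close>. On a simple path no secant vanishes, and the hypotenuse can be
  deformed, square by square, into the two legs of the triangle.\<close>

locale diagonal_path =
  fixes z :: "nat \<Rightarrow> int \<times> int"
  assumes diagonal_step: "diagonal (z (Suc n) - z n)"
begin

abbreviation step :: "nat \<Rightarrow> int \<times> int" where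
  "step n \<equiv> z (Suc n) - z n"

definition secant :: "nat \<Rightarrow> nat \<Rightarrow> int \<times> int" where
  "secant i j = z j - z i"

lemma secant_Suc_right: "secant i (Suc j) = secant i j + step j"
  by (simp add: secant_def)

lemma even_secant: "i \<le> j \<Longrightarrow> even (fst (secant i j) + snd (secant i j))"
proof (induction j rule: dec_induct)
  case base
  show ?case by (simp add: secant_def)
next
  case (step j)
  show ?case
    using step.IH by (cases rule: diagonal_cases[OF diagonal_step[of j]]) (auto simp: secant_Suc_right)
qed

lemma secant_nonzero: "inj_on z A \<Longrightarrow> i \<in> A \<Longrightarrow> j \<in> A \<Longrightarrow> i \<noteq> j \<Longrightarrow> secant i j \<noteq> 0"
  by (auto simp: secant_def inj_on_def)

text \<open>Moving a row of secants from end point \<open>j\<close> to end point \<open>Suc j\<close>. The leftmost index \<open>i\<^sub>0\<close> is left free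
  because the last row of a closed path must avoid the vanishing secant from its start to its end.\<close>

lemma cut_crossing_strip:
  assumes "i\<^sub>0 \<le> m" "m < j" "inj_on z {i\<^sub>0..Suc j}"
  shows "(\<Sum>i=i\<^sub>0..<m. cut_crossing (secant i j) (secant (Suc i) j))
           + cut_crossing (secant m j) (secant m (Suc j))
         = cut_crossing (secant i\<^sub>0 j) (secant i\<^sub>0 (Suc j))
           + (\<Sum>i=i\<^sub>0..<m. cut_crossing (secant i (Suc j)) (secant (Suc i) (Suc j)))"
  using assms(1,2)
proof (induction m rule: dec_induct)
  case base
  show ?case by simp
next
  case (step m)
  note nonzero = secant_nonzero[OF assms(3)]
  have bounds: "i\<^sub>0 \<le> m" "Suc m < j" using step by simp_all
  have corners: "secant m (Suc j) = secant m j + step j" "secant (Suc m) j = secant m j - step m"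
      "secant (Suc m) (Suc j) = secant m j + step j - step m"
    by (simp_all add: secant_def)
  have "cut_crossing (secant m j) (secant m (Suc j)) + cut_crossing (secant m (Suc j)) (secant (Suc m) (Suc j))
      = cut_crossing (secant m j) (secant (Suc m) j) + cut_crossing (secant (Suc m) j) (secant (Suc m) (Suc j))"
    unfolding corners
  proof (rule cut_crossing_square)
    show "even (fst (secant m j) + snd (secant m j))"
      using step.prems by (intro even_secant) simp
    show "secant m j \<noteq> 0" by (rule nonzero; use bounds in simp)
    show "secant m j + step j \<noteq> 0"
      unfolding corners(1)[symmetric] by (rule nonzero; use bounds in simp)
    show "secant m j - step m \<noteq> 0"
      unfolding corners(2)[symmetric] by (rule nonzero; use bounds in simp)
    show "secant m j + step j - step m \<noteq> 0"
      unfolding corners(3)[symmetric] by (rule nonzero; use bounds in simp)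
  qed (rule diagonal_step)+
  with step show ?case by simp
qed

lemma turn_crossing_secant:
  "turn_crossing (step i) (step (Suc i))
   = cut_crossing (secant i (Suc i)) (secant i (Suc (Suc i)))
     + cut_crossing (secant i (Suc (Suc i))) (secant (Suc i) (Suc (Suc i)))"
  by (simp add: turn_crossing_def secant_def)

lemma turn_crossing_triangle:
  assumes "inj_on z {0..Suc n}"
  shows "(\<Sum>i<n. turn_crossing (step i) (step (Suc i)))
         = (\<Sum>j<n. cut_crossing (secant 0 (Suc j)) (secant 0 (Suc (Suc j))))
           + (\<Sum>i=0..<n. cut_crossing (secant i (Suc n)) (secant (Suc i) (Suc n)))"
  using assms
proof (induction n)
  case 0
  show ?case by simp
next
  case (Suc n)
  have "inj_on z {0..Suc n}" by (rule inj_on_subset[OF Suc.prems]) auto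
  then have IH: "(\<Sum>i<n. turn_crossing (step i) (step (Suc i)))
         = (\<Sum>j<n. cut_crossing (secant 0 (Suc j)) (secant 0 (Suc (Suc j))))
           + (\<Sum>i=0..<n. cut_crossing (secant i (Suc n)) (secant (Suc i) (Suc n)))"
    by (rule Suc.IH)
  have "(\<Sum>i=0..<n. cut_crossing (secant i (Suc n)) (secant (Suc i) (Suc n)))
           + cut_crossing (secant n (Suc n)) (secant n (Suc (Suc n)))
         = cut_crossing (secant 0 (Suc n)) (secant 0 (Suc (Suc n)))
           + (\<Sum>i=0..<n. cut_crossing (secant i (Suc (Suc n))) (secant (Suc i) (Suc (Suc n))))"
    by (rule cut_crossing_strip[OF _ _ Suc.prems]) auto
  with IH show ?case by (simp add: turn_crossing_secant)
qed

text \<open>The Umlaufsatz. From the lowest, leftmost point all secants lie in the upper half-plane, and towards it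
  all of them lie in the complement, so that neither leg of the triangle crosses the ray. Only the corner at the
  base point contributes. There the path arrives by \<open>(s, -1)\<close> and leaves by \<open>(s, 1)\<close> with the same \<open>s\<close>, as it
  does not reverse, and \<open>s\<close> is the turning number.\<close>

lemma turning_number_simple_closed:
  assumes inj: "inj_on z {0..<p}" and p: "p > 0" and closed: "z p = z 0" "z (Suc p) = z 1"
    and no_rev: "\<And>i. step i + step (Suc i) \<noteq> 0"
    and lowest: "\<And>j. snd (z 0) < snd (z j) \<or> (snd (z 0) = snd (z j) \<and> fst (z 0) \<le> fst (z j))"
  shows "(\<Sum>i<p. turn_crossing (step i) (step (Suc i))) \<in> {-1, 1}"
proof -
  have "p \<noteq> 1"
    using closed diagonal_step[of 0] by (auto simp: diagonal_def)
  moreover have "p \<noteq> 2"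
    using closed no_rev[of 0] by (auto simp: numeral_2_eq_2)
  ultimately obtain k where k: "p = Suc (Suc (Suc k))"
    using p by (metis Suc_1 One_nat_def gr0_implies_Suc less_Suc_eq_0_disj not0_implies_Suc)
  define q where "q = Suc k"
  have pq: "p = Suc (Suc q)" and q: "0 < q" by (simp_all add: k q_def)
  have inj1: "inj_on z {0..Suc q}"
    by (rule inj_on_subset[OF inj]) (auto simp: pq)
  have inj2: "inj_on z {1..Suc (Suc q)}"
  proof (rule inj_onI)
    fix i j assume ij: "i \<in> {1..Suc (Suc q)}" "j \<in> {1..Suc (Suc q)}" "z i = z j"
    define r where "r i = (if i = p then 0 else i)" for i
    have r: "z (r i) = z i" for i using closed by (simp add: r_def)
    have "z (r i) = z (r j)" unfolding r by (rule ij)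
    then have "r i = r j"
      using ij p by (intro inj_onD[OF inj]) (auto simp: r_def pq split: if_splits)
    then show "i = j" using ij by (auto simp: r_def pq split: if_splits)
  qed
  have upper0: "upper (secant 0 j)" if "0 < j" "j < p" for j
  proof -
    have "secant 0 j \<noteq> 0" using that by (intro secant_nonzero[OF inj]) auto
    then show ?thesis using lowest[of j]
      by (cases "z j"; cases "z 0") (auto simp: upper_def secant_def zero_prod_def)
  qed
  have lower_p: "\<not> upper (secant i p)" for i
    using lowest[of i] closed by (auto simp: upper_def secant_def)
  \<comment> \<open>The triangle is taken up to time \<open>p - 1\<close>; the row to time \<open>p\<close> is then reached only from
    index \<open>1\<close>, which bypasses \<open>secant 0 p = 0\<close>.\<close>
  have T: "(\<Sum>i<q. turn_crossing (step i) (step (Suc i)))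
         = (\<Sum>i=0..<q. cut_crossing (secant i (Suc q)) (secant (Suc i) (Suc q)))"
    using turn_crossing_triangle[OF inj1] upper0 by (simp add: cut_crossing_upper pq)
  have S: "(\<Sum>i=1..<q. cut_crossing (secant i (Suc q)) (secant (Suc i) (Suc q)))
           + cut_crossing (secant q (Suc q)) (secant q p)
         = cut_crossing (secant 1 (Suc q)) (secant 1 p)"
    using cut_crossing_strip[OF _ _ inj2, of q] q lower_p
    by (simp add: cut_crossing_lower flip: pq)
  have turn_q: "turn_crossing (step q) (step (Suc q)) = cut_crossing (secant q (Suc q)) (secant q p)"
    using turn_crossing_secant[of q] lower_p by (simp add: cut_crossing_lower flip: pq)
  have "(\<Sum>i<p. turn_crossing (step i) (step (Suc i)))
        = cut_crossing (secant 0 (Suc q)) (secant 1 (Suc q)) + cut_crossing (secant 1 (Suc q)) (secant 1 p)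
          + turn_crossing (step (Suc q)) (step p)"
    using T S turn_q q by (simp add: pq sum.atLeast_Suc_lessThan)
  moreover define a b where ab: "a = step (Suc q)" "b = step 0"
  then have "secant 0 (Suc q) = - a" "secant 1 (Suc q) = - a - b" "secant 1 p = - b" "step p = b"
    using closed by (simp_all add: secant_def pq)
  ultimately have sum_eq: "(\<Sum>i<p. turn_crossing (step i) (step (Suc i)))
        = cut_crossing (- a) (- a - b) + cut_crossing (- a - b) (- b) + turn_crossing a b"
    by (simp flip: ab)
  have "snd b = 1"
    using lowest[of 1] diagonal_step[of 0] by (auto simp: ab diagonal_def)
  moreover have "snd a = -1"
    using lowest[of "Suc q"] diagonal_step[of "Suc q"] closed by (auto simp: ab diagonal_def pq)
  moreover have "a + b \<noteq> 0"
    using no_rev[of "Suc q"] closed by (simp add: ab pq)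
  moreover have "diagonal a" "diagonal b"
    using diagonal_step by (simp_all add: ab)
  ultimately have "a = (1, -1) \<and> b = (1, 1) \<or> a = (-1, -1) \<and> b = (-1, 1)"
    by (cases rule: diagonal_cases[OF \<open>diagonal a\<close>]; cases rule: diagonal_cases[OF \<open>diagonal b\<close>])
       (auto simp: zero_prod_def)
  then show ?thesis
    unfolding sum_eq by (elim disjE conjE) (simp_all add: turn_crossing_def cut_crossing_def upper_def)
qed

end

section \<open>Bounded orbits are eventually 2-periodic\<close>

lemma int_antiderivative:
  fixes g :: "int \<Rightarrow> int"
  obtains A where "\<And>y. A (y + 1) = A y + g y"
proof
  define A where "A y = (\<Sum>i=0..<y. g i) - (\<Sum>i=y..<0. g i)" for y
  fix y :: int
  show "A (y + 1) = A y + g y"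
  proof (cases "y \<ge> 0")
    case True
    then have "{0..<y + 1} = insert y {0..<y}" by auto
    with True show ?thesis by (simp add: A_def)
  next
    case False
    then have "{y..<0} = insert y {y + 1..<0}" by auto
    with False show ?thesis by (simp add: A_def)
  qed
qed

lemma walk_two_periodic_from:
  assumes "walk u v (N + 2) = walk u v N" "N \<le> n"
  shows "walk u v (n + 2) = walk u v n"
  using assms(2)
proof (induction n rule: dec_induct)
  case (step n)
  have "walk u v (Suc n + 2) = walk u v (Suc (n + 2))" by simp
  also have "\<dots> = walk u v (Suc n)" unfolding walk.simps step.IH ..
  finally show ?case .
qed (rule assms)

text \<open>A bounded orbit is eventually periodic, and one reversal of direction makes it 2-periodic. Otherwise a
  minimal period is a simple closed path without reversal, whose turning number is \<open>\<plusminus>1\<close>. But the turning number is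
  \<open>0\<close>: let \<open>A\<close> and \<open>B\<close> be discrete antiderivatives of the trapezoidal sums \<open>u y + u (y + 1)\<close> and \<open>v x + v (x + 1)\<close>.
  Then the determinant of two consecutive directions is the increment of \<open>B x - A y\<close>, a function of
  the position alone. This is the discrete trace of the fact that \<open>B x - A y\<close> is, up to a factor \<open>2\<close>, the Hamiltonian of the flow
  with velocity \<open>(u y, v x)\<close>.\<close>

lemma walk_eventually_two_periodic_if_bounded:
  assumes u: "\<And>y. u y \<in> {-1, 1}" and v: "\<And>x. v x \<in> {-1, 1}"
    and bounded: "finite (range (walk u v))"
  shows "\<exists>N. \<forall>n\<ge>N. walk u v (n + 2) = walk u v n"
proof (cases "\<exists>n. walk u v (n + 2) = walk u v n")
  case True
  then obtain N where N: "walk u v (N + 2) = walk u v N" by blast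
  then show ?thesis using walk_two_periodic_from by blast
next
  case False
  define P where "P p \<longleftrightarrow> p > 0 \<and> (\<exists>n. walk u v (n + p) = walk u v n)" for p
  have "\<not> inj (walk u v)"
    using bounded finite_imageD infinite_UNIV_nat by blast
  then obtain i j where "i < j" "walk u v i = walk u v j"
    by (metis injI linorder_neqE_nat)
  then have "P (j - i)" unfolding P_def by (intro conjI exI[of _ i]) auto
  define p where "p = (LEAST p. P p)"
  have "P p" unfolding p_def by (rule LeastI) fact
  then obtain N where p: "p > 0" and N: "walk u v (N + p) = walk u v N"
    by (auto simp: P_def)
  have least: "p \<le> q" if "P q" for q unfolding p_def using that by (rule Least_le)
  have periodic: "walk u v (N + k + p) = walk u v (N + k)" for k
  proof (induction k)
    case (Suc k)
    have "walk u v (N + Suc k + p) = walk u v (Suc (N + k + p))" by simp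
    also have "\<dots> = walk u v (Suc (N + k))" unfolding walk.simps Suc ..
    finally show ?case by simp
  qed (use N in simp)
  \<comment> \<open>The base point is the lowest and then leftmost point of the periodic part.\<close>
  define R where "R = (\<lambda>k. walk u v (N + k)) ` UNIV"
  have "finite R" by (rule finite_subset[OF _ bounded]) (auto simp: R_def)
  have "R \<noteq> {}" by (simp add: R_def)
  define b where "b = Min (snd ` R)"
  have b: "b \<in> snd ` R" "\<And>r. r \<in> R \<Longrightarrow> b \<le> snd r"
    using \<open>finite R\<close> \<open>R \<noteq> {}\<close> by (auto simp: b_def)
  define R' where "R' = {r \<in> R. snd r = b}"
  have "finite R'" "R' \<noteq> {}" using \<open>finite R\<close> b by (auto simp: R'_def)
  define a where "a = Min (fst ` R')"
  have a: "a \<in> fst ` R'" "\<And>r. r \<in> R' \<Longrightarrow> a \<le> fst r"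
    using \<open>finite R'\<close> \<open>R' \<noteq> {}\<close> by (auto simp: a_def)
  obtain r where "r \<in> R'" "a = fst r" using a(1) by blast
  then obtain k where k: "fst (walk u v (N + k)) = a" "snd (walk u v (N + k)) = b"
    by (auto simp: R'_def R_def)
  define z where "z n = walk u v (N + k + n)" for n
  have z_Suc: "z (Suc n) = z n + (u (snd (z n)), v (fst (z n)))" for n by (simp add: z_def)
  interpret diagonal_path z
    by standard (use u v in \<open>auto simp: z_Suc diagonal_def\<close>)
  have z_periodic: "z (n + p) = z n" for n
    using periodic[of "k + n"] by (simp add: z_def add_ac)
  \<comment> \<open>Minimality of \<open>p\<close> over all starting times excludes shorter returns anywhere.\<close>
  have inj: "inj_on z {0..<p}"
  proof (rule inj_onI, rule ccontr)
    fix m n assume mn: "m \<in> {0..<p}" "n \<in> {0..<p}" "z m = z n" "m \<noteq> n"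
    have *: False if "m < n" "n < p" "z m = z n" for m n
    proof -
      have "P (n - m)" unfolding P_def
        using that by (intro conjI exI[of _ "N + k + m"]) (auto simp: z_def add.assoc)
      with least[of "n - m"] that show False by linarith
    qed
    show False using *[of m n] *[of n m] mn by (metis atLeastLessThan_iff linorder_neqE_nat)
  qed
  have no_rev: "step i + step (Suc i) \<noteq> 0" for i
  proof
    assume "step i + step (Suc i) = 0"
    then have "z (i + 2) = z i" by simp
    then have "walk u v (N + k + i + 2) = walk u v (N + k + i)" unfolding z_def add.assoc .
    with False show False by blast
  qed
  have lowest: "snd (z 0) < snd (z j) \<or> (snd (z 0) = snd (z j) \<and> fst (z 0) \<le> fst (z j))" for j
  proof -
    have "z j \<in> R" by (auto simp: R_def z_def add.assoc)
    then show ?thesis using b(2)[of "z j"] a(2)[of "z j"] k by (auto simp: z_def R'_def)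
  qed
  have "(\<Sum>i<p. turn_crossing (step i) (step (Suc i))) \<in> {-1, 1}"
    using z_periodic[of 0] z_periodic[of 1] by (intro turning_number_simple_closed inj p no_rev lowest) auto
  moreover have "(\<Sum>i<p. turn_crossing (step i) (step (Suc i))) = 0"
  proof -
    obtain A where A: "\<And>y. A (y + 1) = A y + (u y + u (y + 1))"
      by (rule int_antiderivative[of "\<lambda>y. u y + u (y + 1)"]) auto
    obtain B where B: "\<And>y. B (y + 1) = B y + (v y + v (y + 1))"
      by (rule int_antiderivative[of "\<lambda>y. v y + v (y + 1)"]) auto
    \<comment> \<open>Eight times the turn is an increment of \<open>E\<close>, which returns to its value after one period.\<close>
    define E where "E n = B (fst (z n)) - A (snd (z n)) - 2 * quadrant (step n)" for n
    have A': "A (y + t) - A y = t * (u y + u (y + t))" if "t \<in> {-1, 1}" for y t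
      using that A[of y] A[of "y - 1"] by auto
    have B': "B (y + t) - B y = t * (v y + v (y + t))" if "t \<in> {-1, 1}" for y t
      using that B[of y] B[of "y - 1"] by auto
    have "8 * turn_crossing (step n) (step (Suc n)) = E (Suc n) - E n" for n
    proof -
      have "8 * turn_crossing (step n) (step (Suc n))
            = det2 (step n) (step (Suc n)) + 2 * (quadrant (step n) - quadrant (step (Suc n)))"
        by (rule turn_crossing_eq) (rule diagonal_step no_rev)+
      moreover have "det2 (step n) (step (Suc n)) =
          (B (fst (z (Suc n))) - B (fst (z n))) - (A (snd (z (Suc n))) - A (snd (z n)))"
        using A'[OF v[of "fst (z n)"], of "snd (z n)"] B'[OF u[of "snd (z n)"], of "fst (z n)"]
        by (simp add: z_Suc det2_def algebra_simps)
      ultimately show ?thesis by (simp add: E_def)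
    qed
    then have "8 * (\<Sum>i<p. turn_crossing (step i) (step (Suc i))) = E p - E 0"
      by (simp add: sum_distrib_left sum_lessThan_telescope)
    also have "E p = E 0"
      using z_periodic[of 0] z_periodic[of 1] by (simp add: E_def)
    finally show ?thesis by simp
  qed
  ultimately show ?thesis by simp
qed

section \<open>Families of independent fair signs\<close>

locale fair_signs = prob_space M for M :: "'a measure" +
  fixes W :: "'i \<Rightarrow> 'a \<Rightarrow> int"
  assumes indep: "indep_vars (\<lambda>_. count_space UNIV) W UNIV"
    and sign: "\<omega> \<in> space M \<Longrightarrow> W i \<omega> \<in> {-1, 1}"
    and fair: "s \<in> {-1, 1} \<Longrightarrow> prob {\<omega> \<in> space M. W i \<omega> = s} = 1 / 2"
begin

text \<open>Events are written as predicates of the whole environment \<open>w\<close>, so that not depending on a sign can be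
  expressed by invariance under update of that coordinate.\<close>

abbreviation environments :: "('i \<Rightarrow> int) measure" where
  "environments \<equiv> PiM UNIV (\<lambda>_. count_space UNIV)"

lemma measurable_W [measurable]: "W i \<in> measurable M (count_space UNIV)"
  using indep by (auto simp: indep_vars_def)

lemma measurable_environment [measurable]: "(\<lambda>\<omega> i. W i \<omega>) \<in> measurable M environments"
  by (rule measurable_abs_UNIV) measurable

lemma prob_fresh_sign:
  assumes [measurable]: "Measurable.pred environments P"
    and insensitive: "\<And>w a. P (w(i := a)) \<longleftrightarrow> P w" and s: "s \<in> {-1, 1}"
  shows "prob {\<omega> \<in> space M. P (\<lambda>j. W j \<omega>) \<and> W i \<omega> = s} = prob {\<omega> \<in> space M. P (\<lambda>j. W j \<omega>)} / 2"
proof -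
  let ?N = "\<lambda>A. PiM A (\<lambda>_::'i. count_space (UNIV :: int set))"
  let ?X = "\<lambda>A \<omega>. restrict (\<lambda>j. W j \<omega>) A"
  have ind: "indep_var (?N {i}) (?X {i}) (?N (- {i})) (?X (- {i}))"
    by (rule indep_var_restrict[OF indep]) auto
  have [measurable]: "(\<lambda>w. w(i := 0)) \<in> measurable (?N (- {i})) environments"
    by (rule measurable_fun_upd[where J = "- {i}"]) auto
  define A where "A = {w \<in> space (?N {i}). w i = s}"
  \<comment> \<open>As \<open>P\<close> ignores coordinate \<open>i\<close>, the value \<open>0\<close> there turns it into an event of the other signs alone.\<close>
  define Q where "Q w \<longleftrightarrow> P (w(i := 0))" for w
  define B where "B = {w \<in> space (?N (- {i})). Q w}"
  have A: "A \<in> sets (?N {i})" unfolding A_def by measurable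
  have B: "B \<in> sets (?N (- {i}))" unfolding B_def Q_def by measurable
  have upd: "Q (?X (- {i}) \<omega>) \<longleftrightarrow> P (\<lambda>j. W j \<omega>)" for \<omega>
  proof -
    have "(?X (- {i}) \<omega>)(i := 0) = (\<lambda>j. W j \<omega>)(i := 0)" by auto
    then show ?thesis unfolding Q_def by (simp only: insensitive)
  qed
  have A_eq: "?X {i} -` A \<inter> space M = {\<omega> \<in> space M. W i \<omega> = s}"
    by (auto simp: A_def space_PiM)
  have B_eq: "?X (- {i}) -` B \<inter> space M = {\<omega> \<in> space M. P (\<lambda>j. W j \<omega>)}"
    by (auto simp: B_def space_PiM upd)
  have "(\<lambda>\<omega>. (?X {i} \<omega>, ?X (- {i}) \<omega>)) -` (A \<times> B) \<inter> space M
        = (?X {i} -` A \<inter> space M) \<inter> (?X (- {i}) -` B \<inter> space M)"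
    by auto
  also have "\<dots> = {\<omega> \<in> space M. P (\<lambda>j. W j \<omega>) \<and> W i \<omega> = s}"
    unfolding A_eq B_eq by auto
  finally show ?thesis
    using indep_varD[OF ind A B] unfolding A_eq B_eq fair[OF s] by simp
qed

text \<open>The opposite of another sign is a random target for \<open>W i\<close>, but independent of \<open>W i\<close>; so it is hit with probability
  one half as well.\<close>

lemma prob_fresh_opposite:
  assumes [measurable]: "Measurable.pred environments P"
    and insensitive: "\<And>w a. P (w(i := a)) \<longleftrightarrow> P w" and "i \<noteq> j"
  shows "prob {\<omega> \<in> space M. P (\<lambda>j. W j \<omega>) \<and> W i \<omega> = - W j \<omega>} = prob {\<omega> \<in> space M. P (\<lambda>j. W j \<omega>)} / 2"
proof -
  let ?E = "\<lambda>s. {\<omega> \<in> space M. (P (\<lambda>j. W j \<omega>) \<and> W j \<omega> = - s) \<and> W i \<omega> = s}"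
  let ?F = "\<lambda>s. {\<omega> \<in> space M. P (\<lambda>j. W j \<omega>) \<and> W j \<omega> = - s}"
  have half: "prob (?E s) = prob (?F s) / 2" if "s \<in> {-1, 1}" for s
    by (rule prob_fresh_sign[where P = "\<lambda>w. P w \<and> w j = - s"])
       (use that \<open>i \<noteq> j\<close> insensitive in \<open>auto intro!: pred_intros_logic\<close>)
  have "{\<omega> \<in> space M. P (\<lambda>j. W j \<omega>) \<and> W i \<omega> = - W j \<omega>} = ?E 1 \<union> ?E (-1)"
    using sign[of _ j] by (force simp: minus_equation_iff)
  then have "prob {\<omega> \<in> space M. P (\<lambda>j. W j \<omega>) \<and> W i \<omega> = - W j \<omega>} = prob (?E 1) + prob (?E (-1))"
    by (simp only:) (rule finite_measure_Union; auto)
  also have "\<dots> = (prob (?F 1) + prob (?F (-1))) / 2"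
    using half[of 1] half[of "-1"] by simp
  also have "prob (?F 1) + prob (?F (-1)) = prob (?F 1 \<union> ?F (-1))"
    by (rule finite_measure_Union[symmetric]; auto)
  also have "?F 1 \<union> ?F (-1) = {\<omega> \<in> space M. P (\<lambda>j. W j \<omega>)}"
    using sign[of _ j] by force
  finally show ?thesis .
qed

text \<open>Disjoint blocks of length \<open>L\<close> are constantly \<open>s\<close> with probability \<open>2 ^ (- L)\<close> each, independently. Hence
  the probability \<open>p K\<close> that none of the first \<open>K\<close> blocks is constant decays geometrically.\<close>

lemma AE_constant_block:
  fixes f :: "nat \<Rightarrow> 'i"
  assumes "inj f" and s: "s \<in> {-1, 1}"
  shows "AE \<omega> in M. \<exists>k. \<forall>l<L. W (f (k * L + l)) \<omega> = s"
proof -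
  define block where "block k r w \<longleftrightarrow> (\<forall>l<r. w (f (k * L + l)) = s)" for k r and w :: "'i \<Rightarrow> int"
  define none where "none K w \<longleftrightarrow> (\<forall>k<K. \<not> block k L w)" for K w
  have [measurable]: "Measurable.pred environments (block k r)" for k r
    unfolding block_def by measurable
  have [measurable]: "Measurable.pred environments (none K)" for K
    unfolding none_def by measurable
  define p where "p K = prob {\<omega> \<in> space M. none K (\<lambda>i. W i \<omega>)}" for K
  have prefix: "prob {\<omega> \<in> space M. none K (\<lambda>i. W i \<omega>) \<and> block K r (\<lambda>i. W i \<omega>)} = p K / 2 ^ r" for K r
  proof (induction r)
    case 0
    show ?case by (simp add: block_def p_def)
  next
    case (Suc r)
    have index: "k * L + l \<noteq> K * L + r" if "k < K" "l < L" for k l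
    proof -
      have "k * L + l < Suc k * L" using that by simp
      also have "\<dots> \<le> K * L" using that by (intro mult_right_mono) auto
      finally show ?thesis by simp
    qed
    have "prob {\<omega> \<in> space M. (none K (\<lambda>i. W i \<omega>) \<and> block K r (\<lambda>i. W i \<omega>)) \<and> W (f (K * L + r)) \<omega> = s}
          = prob {\<omega> \<in> space M. none K (\<lambda>i. W i \<omega>) \<and> block K r (\<lambda>i. W i \<omega>)} / 2"
    proof (rule prob_fresh_sign[where P = "\<lambda>w. none K w \<and> block K r w"])
      fix w :: "'i \<Rightarrow> int" and a
      show "none K (w(f (K * L + r) := a)) \<and> block K r (w(f (K * L + r) := a)) \<longleftrightarrow> none K w \<and> block K r w"
        using index by (simp add: none_def block_def inj_eq[OF \<open>inj f\<close>] cong: conj_cong)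
    qed (use s in auto)
    moreover have "block K (Suc r) w \<longleftrightarrow> block K r w \<and> w (f (K * L + r)) = s" for w
      by (auto simp: block_def less_Suc_eq)
    ultimately show ?case using Suc.IH by (simp add: conj_assoc)
  qed
  have p_Suc: "p (Suc K) = (1 - 1 / 2 ^ L) * p K" for K
  proof -
    have "{\<omega> \<in> space M. none (Suc K) (\<lambda>i. W i \<omega>)}
          = {\<omega> \<in> space M. none K (\<lambda>i. W i \<omega>)}
            - {\<omega> \<in> space M. none K (\<lambda>i. W i \<omega>) \<and> block K L (\<lambda>i. W i \<omega>)}"
      by (auto simp: none_def less_Suc_eq)
    then have "p (Suc K) = p K - p K / 2 ^ L"
      unfolding p_def prefix[symmetric, unfolded p_def]
      by (simp only:) (rule finite_measure_Diff; auto)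
    then show ?thesis by (simp add: algebra_simps)
  qed
  have p_le: "p K \<le> (1 - 1 / 2 ^ L) ^ K" for K
    by (induction K) (auto simp: p_Suc p_def[of 0] intro!: mult_left_mono)
  have "prob {\<omega> \<in> space M. \<forall>k. \<not> block k L (\<lambda>i. W i \<omega>)} \<le> (1 - 1 / 2 ^ L) ^ K" for K
    using p_le[of K] unfolding p_def
    by (rule order_trans[rotated]) (auto intro!: finite_measure_mono simp: none_def)
  moreover have "(\<lambda>K. (1 - 1 / 2 ^ L :: real) ^ K) \<longlonglongrightarrow> 0"
    by (intro LIMSEQ_realpow_zero) auto
  ultimately have "prob {\<omega> \<in> space M. \<forall>k. \<not> block k L (\<lambda>i. W i \<omega>)} \<le> 0"
    by (intro LIMSEQ_le_const) auto
  then have "prob {\<omega> \<in> space M. \<forall>k. \<not> block k L (\<lambda>i. W i \<omega>)} = 0"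
    by (simp add: measure_le_0_iff)
  then have "AE \<omega> in M. \<not> (\<forall>k. \<not> block k L (\<lambda>i. W i \<omega>))"
    by (subst (asm) prob_Collect_eq_0) auto
  then show ?thesis by (simp add: block_def)
qed

text \<open>Reflections and the exchange of rows and columns act on the environment by such maps; this transfers
  a bound on one side to the three other sides.\<close>

lemma fair_signs_transform:
  fixes \<pi> :: "'j \<Rightarrow> 'i"
  assumes "inj \<pi>" and \<sigma>: "\<And>i. \<sigma> i \<in> {-1, 1}"
  shows "fair_signs M (\<lambda>i \<omega>. \<sigma> i * W (\<pi> i) \<omega>)"
proof
  \<comment> \<open>Injectivity makes the sets \<open>{\<pi> j}\<close> disjoint, and grouping by disjoint sets preserves independence.\<close>
  have "indep_vars (\<lambda>j. PiM {\<pi> j} (\<lambda>_. count_space UNIV)) (\<lambda>j \<omega>. restrict (\<lambda>i. W i \<omega>) {\<pi> j}) UNIV"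
    using \<open>inj \<pi>\<close> by (intro indep_vars_restrict[OF indep]) (auto simp: disjoint_family_on_def inj_eq)
  then have "indep_vars (\<lambda>_. count_space UNIV) (\<lambda>j \<omega>. \<sigma> j * (restrict (\<lambda>i. W i \<omega>) {\<pi> j}) (\<pi> j)) UNIV"
    by (rule indep_vars_compose2) measurable
  then show "indep_vars (\<lambda>_. count_space UNIV) (\<lambda>i \<omega>. \<sigma> i * W (\<pi> i) \<omega>) UNIV" by simp
next
  fix i \<omega> assume "\<omega> \<in> space M"
  then show "\<sigma> i * W (\<pi> i) \<omega> \<in> {-1, 1}" using sign[of \<omega> "\<pi> i"] \<sigma>[of i] by auto
next
  fix s i assume "s \<in> {-1, 1 :: int}"
  then have "\<sigma> i * W (\<pi> i) \<omega> = s \<longleftrightarrow> W (\<pi> i) \<omega> = \<sigma> i * s" for \<omega>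
    using \<sigma>[of i] by auto
  then show "prob {\<omega> \<in> space M. \<sigma> i * W (\<pi> i) \<omega> = s} = 1 / 2"
    using fair[of "\<sigma> i * s" "\<pi> i"] \<sigma>[of i] \<open>s \<in> {-1, 1}\<close> by auto
qed

end

section \<open>The walk at a new rightmost column\<close>

(* Unfolding the recursion would replace walk u v (Suc n), the position at which a column is first
   reached, by an expression in the previous position. *)
declare walk.simps(2) [simp del]

text \<open>The event that the walk arrives for the first time in column \<open>m\<close>, right of the start, and will step back to the left:
  then one sign, that of column \<open>m\<close>, decides whether it is trapped. This sign is fresh, because the walk
  has consulted only columns left of \<open>m\<close> so far.\<close>

definition blocked :: "(int \<Rightarrow> int) \<Rightarrow> (int \<Rightarrow> int) \<Rightarrow> int \<Rightarrow> bool" where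
  "blocked u v m \<longleftrightarrow> (\<exists>n. (\<forall>k\<le>n. fst (walk u v k) < m) \<and> fst (walk u v (Suc n)) = m
     \<and> u (snd (walk u v (Suc n))) = -1)"

lemma walk_cong_left:
  assumes "\<And>x. x < m \<Longrightarrow> v' x = v x" and "\<forall>k\<le>n. fst (walk u v k) < m"
  shows "walk u v' (Suc n) = walk u v (Suc n)"
  using assms(2) by (induction n) (auto simp: assms(1) walk.simps)

lemma blocked_upd: "blocked u (v(m := a)) m \<longleftrightarrow> blocked u v m"
proof -
  have "blocked u v' m" if v': "\<And>x. x < m \<Longrightarrow> v' x = v x" and "blocked u v m" for v v'
  proof -
    from \<open>blocked u v m\<close> obtain n where n: "\<forall>k\<le>n. fst (walk u v k) < m" "fst (walk u v (Suc n)) = m"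
        "u (snd (walk u v (Suc n))) = -1"
      unfolding blocked_def by blast
    have "walk u v' k = walk u v k" if "k \<le> Suc n" for k
    proof (cases k)
      case (Suc l)
      with that n(1) show ?thesis by (simp only:) (intro walk_cong_left[of m] v'; simp)
    qed simp
    with n show ?thesis unfolding blocked_def by (intro exI[of _ n]) simp
  qed
  from this[of "v(m := a)" v] this[of v "v(m := a)"] show ?thesis by auto
qed

text \<open>Having come to column \<open>m\<close> from column \<open>m - 1\<close>, the walk is sent back horizontally by the row and vertically by
  the column. So it has reversed its direction and stays between these two columns forever.\<close>

lemma blocked_reversal_maximum:
  assumes u: "\<And>y. u y \<in> {-1, 1}" and "blocked u v m" and reversal: "v m = - v (m - 1)"
  shows "(\<forall>n. fst (walk u v n) \<le> m) \<and> (\<exists>n. fst (walk u v n) = m)"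
proof -
  from \<open>blocked u v m\<close> obtain n where n: "\<forall>k\<le>n. fst (walk u v k) < m" "fst (walk u v (Suc n)) = m"
      "u (snd (walk u v (Suc n))) = -1"
    unfolding blocked_def by blast
  have x: "fst (walk u v n) = m - 1 \<and> u (snd (walk u v n)) = 1"
    using n(1,2) u[of "snd (walk u v n)"] by (force simp: walk.simps)
  have "walk u v (n + 2) = walk u v n"
    using n(2,3) x reversal by (cases "walk u v n") (simp add: zero_prod_def walk.simps)
  note periodic = walk_two_periodic_from[OF this]
  have "fst (walk u v k) \<le> m" for k
  proof (induction k rule: less_induct)
    case (less k)
    consider "k \<le> Suc n" | "k \<ge> n + 2" by linarith
    then show ?case
    proof cases
      case 1
      with n show ?thesis by (cases "k = Suc n") (auto simp: le_Suc_eq order.strict_implies_order)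
    next
      case 2
      then have "n \<le> k - 2" "k - 2 + 2 = k" "k - 2 < k" by simp_all
      with periodic[of "k - 2"] less[of "k - 2"] show ?thesis by simp
    qed
  qed
  with n(2) show ?thesis by blast
qed

lemma first_arrival:
  assumes u: "\<And>y. u y \<in> {-1, 1}" and "m > 0" "fst (walk u v n) \<ge> m"
  obtains k where "\<forall>j\<le>k. fst (walk u v j) < m" "fst (walk u v (Suc k)) = m"
proof -
  define l where "l = (LEAST l. fst (walk u v l) \<ge> m)"
  have l: "fst (walk u v l) \<ge> m"
    unfolding l_def by (rule LeastI) fact
  have less: "fst (walk u v j) < m" if "j < l" for j
    using that not_less_Least[of j "\<lambda>l. fst (walk u v l) \<ge> m"] unfolding l_def by force
  have "l \<noteq> 0" using l \<open>m > 0\<close> by (intro notI) simp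
  then obtain k where k: "l = Suc k" by (cases l) auto
  have "fst (walk u v (Suc k)) = m"
    using less[of k] l u[of "snd (walk u v k)"] by (auto simp: k walk.simps)
  with less that[of k] show ?thesis by (simp add: k less_Suc_eq_le)
qed

text \<open>Suppose that all columns are reached. When new columns are no longer blocked, the walk moves to
  the right at each step, through rows with \<open>u = 1\<close> only. Its height is confined between two rows with \<open>u = -1\<close>,
  since it changes by one at a time. But at each new column the vertical step is the sign of that
  column, and a long run of signs \<open>1\<close> would carry it across the upper of these rows.\<close>

lemma bounded_right_if_eventually_not_blocked:
  assumes u: "\<And>y. u y \<in> {-1, 1}" and v: "\<And>x. v x \<in> {-1, 1}"
    and not_blocked: "\<And>m. m \<ge> m\<^sub>0 \<Longrightarrow> \<not> blocked u v m"
    and above: "\<And>b. \<exists>y>b. u y = -1" and below: "\<And>b. \<exists>y<b. u y = -1"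
    and runs: "\<And>m L. \<exists>x\<ge>m. \<forall>l<L. v (x + int l) = 1"
  shows "\<exists>B. \<forall>n. fst (walk u v n) \<le> B"
proof (rule ccontr)
  assume unbounded: "\<not> (\<exists>B. \<forall>n. fst (walk u v n) \<le> B)"
  define m where "m = max m\<^sub>0 1"
  obtain n where "fst (walk u v n) > m" using unbounded by (meson not_le)
  then obtain n\<^sub>0 where n0: "\<forall>j\<le>n\<^sub>0. fst (walk u v j) < m" "fst (walk u v (Suc n\<^sub>0)) = m"
    by (elim first_arrival[OF u, rotated, OF less_imp_le]) (auto simp: m_def)
  define X Y where "X k = fst (walk u v (Suc n\<^sub>0 + k))" and "Y k = snd (walk u v (Suc n\<^sub>0 + k))" for k
  have X_Suc: "X (Suc k) = X k + u (Y k)" and Y_Suc: "Y (Suc k) = Y k + v (X k)" for k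
    by (simp_all add: X_def Y_def walk.simps)
  have XY: "X k = m + int k \<and> u (Y k) = 1" for k
  proof (induction k rule: less_induct)
    case (less k)
    have X: "X k = m + int k"
    proof (cases k)
      case 0
      then show ?thesis using n0 by (simp add: X_def)
    next
      case (Suc l)
      then show ?thesis using less[of l] by (simp add: X_Suc)
    qed
    have "fst (walk u v j) < m + int k" if "j \<le> n\<^sub>0 + k" for j
    proof (cases "j \<le> n\<^sub>0")
      case True
      then show ?thesis using n0(1) by (force intro: less_le_trans)
    next
      case False
      then obtain l where l: "j = Suc n\<^sub>0 + l" by (metis less_eq_Suc_le le_Suc_ex not_le)
      then have "l < k" using that by simp
      then show ?thesis using less[of l] by (simp add: l X_def)
    qed
    moreover have "\<not> blocked u v (m + int k)"
      by (rule not_blocked) (simp add: m_def)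
    ultimately have "u (Y k) \<noteq> -1"
      using X unfolding blocked_def X_def Y_def by (metis add_Suc)
    with X u[of "Y k"] show ?case by auto
  qed
  obtain a b where a: "a < Y 0" "u a = -1" and b: "Y 0 < b" "u b = -1"
    using above below by blast
  have Y_bounds: "a < Y k \<and> Y k < b" for k
  proof (induction k)
    case (Suc k)
    have "Y (Suc k) \<noteq> a" "Y (Suc k) \<noteq> b"
      using XY[of "Suc k"] a b by auto
    then show ?case using Suc v[of "X k"] by (auto simp: Y_Suc)
  qed (use a b in simp)
  obtain x where x: "x \<ge> m" "\<forall>l<nat (b - a). v (x + int l) = 1" using runs by blast
  define k where "k = nat (x - m)"
  have "Y (k + l) = Y k + int l" if "l \<le> nat (b - a)" for l
    using that
  proof (induction l)
    case (Suc l)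
    have "X (k + l) = x + int l" using XY[of "k + l"] x(1) by (simp add: k_def)
    then show ?case using Suc x(2) by (simp add: Y_Suc)
  qed simp
  from this[of "nat (b - a)"] show False
    using Y_bounds[of k] Y_bounds[of "k + nat (b - a)"] by simp
qed

section \<open>Almost sure boundedness\<close>

lemma walk_swap: "walk v u n = prod.swap (walk u v n)"
  by (induction n) (simp_all add: walk.simps(2) plus_prod_def)

lemma walk_reflect: "walk (\<lambda>y. - u y) (\<lambda>x. v (- x)) n = (- fst (walk u v n), snd (walk u v n))"
  by (induction n) (auto simp: walk.simps(2))

locale random_lines = fair_signs M W for M :: "'a measure" and W :: "int + int \<Rightarrow> 'a \<Rightarrow> int"
begin

abbreviation walk_at :: "'a \<Rightarrow> nat \<Rightarrow> int \<times> int" where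
  "walk_at \<omega> \<equiv> walk (\<lambda>y. W (Inl y) \<omega>) (\<lambda>x. W (Inr x) \<omega>)"

lemma measurable_walk:
  "(\<lambda>w. walk (\<lambda>y. w (Inl y)) (\<lambda>x. w (Inr x)) n) \<in> measurable environments (count_space UNIV)"
proof (induction n)
  case (Suc n)
  have coordinate: "(\<lambda>w. w i) \<in> measurable environments (count_space UNIV)" for i
    by measurable
  have "(\<lambda>w. p + (w (Inl (snd p)), w (Inr (fst p)))) \<in> measurable environments (count_space UNIV)" for p
    by (rule measurable_compose_countable[where g = "\<lambda>w. w (Inl (snd p))" and f = "\<lambda>a w. p + (a, w (Inr (fst p)))"],
        rule measurable_compose_countable[where g = "\<lambda>w. w (Inr (fst p))" and f = "\<lambda>b w. p + (_, b)"])
       (rule measurable_const coordinate; simp)+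
  then show ?case unfolding walk.simps
    by (rule measurable_compose_countable[where f = "\<lambda>p w. p + (w (Inl (snd p)), w (Inr (fst p)))"]) (rule Suc)
qed simp

lemma measurable_blocked:
  "Measurable.pred environments (\<lambda>w. blocked (\<lambda>y. w (Inl y)) (\<lambda>x. w (Inr x)) m)"
proof -
  define Z where "Z n w = walk (\<lambda>y. w (Inl y)) (\<lambda>x. w (Inr x)) n" for n and w :: "int + int \<Rightarrow> int"
  have Z: "Z n \<in> measurable environments (count_space UNIV)" for n
    unfolding Z_def by (rule measurable_walk)
  define earlier where "earlier n w \<longleftrightarrow> fst (Z n w) < m" for n w
  define arrived where "arrived n w \<longleftrightarrow> fst (Z n w) = m" for n w
  define negative where "negative n w \<longleftrightarrow> w (Inl (snd (Z n w))) = -1" for n w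
  have [measurable]: "Measurable.pred environments (earlier n)" for n
    unfolding earlier_def by (rule measurable_compose[OF Z]) simp
  have [measurable]: "Measurable.pred environments (arrived n)" for n
    unfolding arrived_def by (rule measurable_compose[OF Z]) simp
  have [measurable]: "Measurable.pred environments (negative n)" for n
    unfolding negative_def
    by (rule measurable_compose_countable[where f = "\<lambda>p w. w (Inl (snd p)) = -1", OF _ Z]) measurable
  have "Measurable.pred environments (\<lambda>w. \<exists>n. (\<forall>k\<le>n. earlier k w) \<and> arrived (Suc n) w \<and> negative (Suc n) w)"
    by measurable
  then show ?thesis unfolding blocked_def earlier_def arrived_def negative_def Z_def .
qed

text \<open>When column \<open>m\<close> is blocked, its sign is still fresh, and with probability one half it is the opposite of
  the sign of column \<open>m - 1\<close>. This makes \<open>m\<close> the maximal abscissa of the orbit, an event \<open>T m\<close> that occurs for at most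
  one \<open>m\<close>. So the probabilities of blocking have sum at most \<open>2\<close>, and the Borel--Cantelli lemma applies.\<close>

lemma AE_eventually_not_blocked:
  "AE \<omega> in M. \<exists>m\<^sub>0. \<forall>m\<ge>m\<^sub>0. \<not> blocked (\<lambda>y. W (Inl y) \<omega>) (\<lambda>x. W (Inr x) \<omega>) m"
proof -
  define A where "A m = {\<omega> \<in> space M. blocked (\<lambda>y. W (Inl y) \<omega>) (\<lambda>x. W (Inr x) \<omega>) (int m)}" for m
  define T where "T m = {\<omega> \<in> space M. blocked (\<lambda>y. W (Inl y) \<omega>) (\<lambda>x. W (Inr x) \<omega>) (int m)
      \<and> W (Inr (int m)) \<omega> = - W (Inr (int m - 1)) \<omega>}" for m
  have pred: "Measurable.pred M (\<lambda>\<omega>. blocked (\<lambda>y. W (Inl y) \<omega>) (\<lambda>x. W (Inr x) \<omega>) m)" for m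
    using measurable_compose[OF measurable_environment measurable_blocked] .
  note [measurable] = pred
  have A_sets: "A m \<in> sets M" for m unfolding A_def by measurable
  have T_sets: "T m \<in> sets M" for m unfolding T_def by measurable
  have half: "prob (T m) = prob (A m) / 2" for m
    unfolding A_def T_def
    by (rule prob_fresh_opposite[where P = "\<lambda>w. blocked (\<lambda>y. w (Inl y)) (\<lambda>x. w (Inr x)) (int m)"])
       (auto simp: measurable_blocked blocked_upd[unfolded fun_upd_def] fun_upd_def)
  have maximum: "(\<forall>n. fst (walk_at \<omega> n) \<le> int m) \<and> (\<exists>n. fst (walk_at \<omega> n) = int m)" if "\<omega> \<in> T m" for \<omega> m
    using that sign[of \<omega>] unfolding T_def by (intro blocked_reversal_maximum) auto
  have disjoint: "disjoint_family T"
    unfolding disjoint_family_on_def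
  proof (intro ballI impI)
    fix m n :: nat assume "m \<noteq> n"
    show "T m \<inter> T n = {}"
    proof (rule equals0I)
      fix \<omega> assume "\<omega> \<in> T m \<inter> T n"
      then have "int m \<le> int n" "int n \<le> int m"
        using maximum[of \<omega> m] maximum[of \<omega> n] by (metis IntE)+
      with \<open>m \<noteq> n\<close> show False by simp
    qed
  qed
  have "(\<Sum>m<K. prob (T m)) = prob (\<Union>m<K. T m)" for K
    using T_sets disjoint
    by (intro finite_measure_finite_Union[symmetric]) (auto intro: disjoint_family_on_mono)
  then have "summable (\<lambda>m. prob (T m))"
    by (intro bounded_imp_summable[where B = 1]) (auto simp flip: lessThan_Suc_atMost)
  then have "summable (\<lambda>m. 2 * prob (T m))" by (rule summable_mult)
  then have "summable (\<lambda>m. prob (A m))" by (simp add: half)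
  then have "AE \<omega> in M. eventually (\<lambda>m. \<omega> \<in> space M - A m) sequentially"
    using A_sets by (intro borel_cantelli_AE1) (auto simp: emeasure_eq_measure)
  then show ?thesis
  proof eventually_elim
    case (elim \<omega>)
    then obtain k where k: "\<And>m. m \<ge> k \<Longrightarrow> \<omega> \<in> space M - A m"
      by (auto simp: eventually_sequentially)
    have "\<not> blocked (\<lambda>y. W (Inl y) \<omega>) (\<lambda>x. W (Inr x) \<omega>) m" if "m \<ge> int k" for m
      using k[of "nat m"] that by (auto simp: A_def)
    then show ?case by blast
  qed
qed

lemma AE_bounded_right: "AE \<omega> in M. \<exists>B. \<forall>n. fst (walk_at \<omega> n) \<le> B"
proof -
  have runs: "AE \<omega> in M. \<forall>m L. \<exists>k. \<forall>l<L. W (Inr (m + int (k * L + l))) \<omega> = 1"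
    unfolding AE_all_countable
    by (intro allI AE_constant_block[where f = "\<lambda>k. Inr (_ + int k)"]) (auto intro: injI)
  have above: "AE \<omega> in M. \<forall>b. \<exists>k. \<forall>l<1. W (Inl (b + 1 + int (k * 1 + l))) \<omega> = -1"
    unfolding AE_all_countable
    by (intro allI AE_constant_block[where f = "\<lambda>k. Inl (_ + 1 + int k)"]) (auto intro: injI)
  have below: "AE \<omega> in M. \<forall>b. \<exists>k. \<forall>l<1. W (Inl (b - 1 - int (k * 1 + l))) \<omega> = -1"
    unfolding AE_all_countable
    by (intro allI AE_constant_block[where f = "\<lambda>k. Inl (_ - 1 - int k)"]) (auto intro: injI)
  \<comment> \<open>The rows with sign \<open>-1\<close> above and below any height are constant blocks of length \<open>1\<close>.\<close>
  from AE_space AE_eventually_not_blocked runs above below show ?thesis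
  proof eventually_elim
    case (elim \<omega>)
    from elim(2) obtain m\<^sub>0 where m0: "\<And>m. m \<ge> m\<^sub>0 \<Longrightarrow> \<not> blocked (\<lambda>y. W (Inl y) \<omega>) (\<lambda>x. W (Inr x) \<omega>) m"
      by blast
    show ?case
    proof (rule bounded_right_if_eventually_not_blocked[OF _ _ m0])
      fix b
      from elim(4) obtain k where "W (Inl (b + 1 + int k)) \<omega> = -1" by auto
      then show "\<exists>y>b. W (Inl y) \<omega> = -1" by (intro exI[of _ "b + 1 + int k"]) auto
      from elim(5) obtain k where "W (Inl (b - 1 - int k)) \<omega> = -1" by auto
      then show "\<exists>y<b. W (Inl y) \<omega> = -1" by (intro exI[of _ "b - 1 - int k"]) auto
    next
      fix m L
      from elim(3) obtain k where "\<forall>l<L. W (Inr (m + int (k * L + l))) \<omega> = 1" by blast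
      then show "\<exists>x\<ge>m. \<forall>l<L. W (Inr (x + int l)) \<omega> = 1"
        by (intro exI[of _ "m + int (k * L)"]) (auto simp: add.assoc)
    qed (use sign[OF elim(1)] in auto)
  qed
qed

lemma AE_bounded_horizontally: "AE \<omega> in M. \<exists>B. \<forall>n. \<bar>fst (walk_at \<omega> n)\<bar> \<le> B"
proof -
  define \<sigma> :: "int + int \<Rightarrow> int" where "\<sigma> = case_sum (\<lambda>_. -1) (\<lambda>_. 1)"
  define \<pi> :: "int + int \<Rightarrow> int + int" where "\<pi> = case_sum Inl (\<lambda>x. Inr (- x))"
  have "fair_signs M (\<lambda>i \<omega>. \<sigma> i * W (\<pi> i) \<omega>)"
    by (rule fair_signs_transform) (auto simp: \<pi>_def \<sigma>_def inj_def split: sum.splits)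
  then interpret reflected: random_lines M "\<lambda>i \<omega>. \<sigma> i * W (\<pi> i) \<omega>"
    by (rule random_lines.intro)
  have "reflected.walk_at \<omega> n = (- fst (walk_at \<omega> n), snd (walk_at \<omega> n))" for \<omega> n
    using walk_reflect[of "\<lambda>y. W (Inl y) \<omega>" "\<lambda>x. W (Inr x) \<omega>"] by (simp add: \<sigma>_def \<pi>_def)
  with reflected.AE_bounded_right have "AE \<omega> in M. \<exists>B. \<forall>n. - fst (walk_at \<omega> n) \<le> B" by simp
  with AE_bounded_right show ?thesis
  proof eventually_elim
    case (elim \<omega>)
    then obtain B C where B: "\<And>n. fst (walk_at \<omega> n) \<le> B" and C: "\<And>n. - fst (walk_at \<omega> n) \<le> C" by blast
    have "\<bar>fst (walk_at \<omega> n)\<bar> \<le> max B C" for n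
      using B[of n] C[of n] by (intro abs_leI) (auto simp: le_max_iff_disj)
    then show ?case by blast
  qed
qed

lemma AE_finite_range: "AE \<omega> in M. finite (range (walk_at \<omega>))"
proof -
  define \<pi> :: "int + int \<Rightarrow> int + int" where "\<pi> = case_sum Inr Inl"
  have "fair_signs M (\<lambda>i \<omega>. 1 * W (\<pi> i) \<omega>)"
    by (rule fair_signs_transform) (auto simp: \<pi>_def inj_def split: sum.splits)
  then have "fair_signs M (\<lambda>i. W (\<pi> i))" by simp
  then interpret swapped: random_lines M "\<lambda>i. W (\<pi> i)"
    by (rule random_lines.intro)
  have "swapped.walk_at \<omega> n = prod.swap (walk_at \<omega> n)" for \<omega> n
    using walk_swap[of "\<lambda>y. W (Inr y) \<omega>" "\<lambda>x. W (Inl x) \<omega>"] by (simp add: \<pi>_def)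
  with swapped.AE_bounded_horizontally have "AE \<omega> in M. \<exists>B. \<forall>n. \<bar>snd (walk_at \<omega> n)\<bar> \<le> B" by simp
  with AE_bounded_horizontally show ?thesis
  proof eventually_elim
    case (elim \<omega>)
    then obtain B C where "\<And>n. \<bar>fst (walk_at \<omega> n)\<bar> \<le> B" "\<And>n. \<bar>snd (walk_at \<omega> n)\<bar> \<le> C" by blast
    then have "walk_at \<omega> n \<in> {-B..B} \<times> {-C..C}" for n
      by (auto simp: mem_Times_iff abs_le_iff minus_le_iff)
    then have "range (walk_at \<omega>) \<subseteq> {-B..B} \<times> {-C..C}" by blast
    then show ?case by (rule finite_subset) simp
  qed
qed

end

text \<open>The rows and the columns together form one family of fair signs indexed by \<open>int + int\<close>.\<close>

theorem theorem1:
  fixes M :: "'a measure" and U V :: "int \<Rightarrow> 'a \<Rightarrow> int" and Z :: "nat \<Rightarrow> 'a \<Rightarrow> int \<times> int"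
  assumes "prob_space M"
    and "prob_space.indep_vars M (\<lambda>_. count_space UNIV) (case_sum U V) (UNIV :: (int + int) set)"
    and "\<And>y \<omega>. \<omega> \<in> space M \<Longrightarrow> U y \<omega> \<in> {-1, 1}"
    and "\<And>x \<omega>. \<omega> \<in> space M \<Longrightarrow> V x \<omega> \<in> {-1, 1}"
    and "\<And>y. \<P>(\<omega> in M. U y \<omega> = 1) = 1 / 2" and "\<And>y. \<P>(\<omega> in M. U y \<omega> = -1) = 1 / 2"
    and "\<And>x. \<P>(\<omega> in M. V x \<omega> = 1) = 1 / 2" and "\<And>x. \<P>(\<omega> in M. V x \<omega> = -1) = 1 / 2"
    and "\<And>n \<omega>. Z n \<omega> = walk (\<lambda>y. U y \<omega>) (\<lambda>x. V x \<omega>) n"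
  shows "AE \<omega> in M. \<exists>N. \<forall>n\<ge>N. Z (n + 2) \<omega> = Z n \<omega>"
proof -
  have fair: "Sigma_Algebra.measure M {\<omega> \<in> space M. case_sum U V i \<omega> = s} = 1 / 2" if "s \<in> {-1, 1}" for i s
    using that assms(5-8) by (cases i) auto
  have sign: "case_sum U V i \<omega> \<in> {-1, 1}" if "\<omega> \<in> space M" for i \<omega>
    using assms(3,4)[OF that] by (cases i) auto
  interpret random_lines M "case_sum U V"
    by (intro random_lines.intro fair_signs.intro fair_signs_axioms.intro assms(1,2) sign fair)
  from AE_space AE_finite_range show ?thesis
  proof eventually_elim
    case (elim \<omega>)
    have "\<exists>N. \<forall>n\<ge>N. walk_at \<omega> (n + 2) = walk_at \<omega> n"
      using elim sign[OF elim(1)] by (intro walk_eventually_two_periodic_if_bounded) blast+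
    then show ?case by (simp add: assms(9))
  qed
qed

end
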